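(* Let $m\ge 3$ and let $C_1,C_2,\ldots,C_m$ be $n\times n$ real symmetric matrices with $C_1$ invertible. The collection $\{C_1,\ldots,C_m\}$ is SDC if and only if for each $2\le i\le m$ the matrix $C_1^{-1}C_i$ is real similarly diagonalizable and the matrices $C_jC_1^{-1}C_i$, $2\le i<j\le m$, are all symmetric.
   Context: A collection of $n\times n$ real symmetric matrices $\{C_1,\ldots,C_m\}$ is SDC (simultaneously diagonalizable via congruence) if there is a nonsingular real matrix $P$ such that $P^TC_iP$ is (real) diagonal for every $i$. A real square matrix $M$ is real similarly diagonalizable if there is a nonsingular real matrix $H$ with $H^{-1}MH$ real diagonal. *)

theory Defs
  imports "HOL-Analysis.Analysis"
begin

definition symmetric_matrix :: "'a ^ 'n ^ 'n \<Rightarrow> bool" where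
  "symmetric_matrix A \<longleftrightarrow> transpose A = A"

definition diagonal_matrix :: "'a::zero ^ 'n ^ 'n \<Rightarrow> bool" where
  "diagonal_matrix A \<longleftrightarrow> (\<forall>i j. i \<noteq> j \<longrightarrow> A $ i $ j = 0)"

definition SDC :: "(real ^ 'n ^ 'n) set \<Rightarrow> bool" where
  "SDC \<C> \<longleftrightarrow>
    (\<exists>P :: real ^ 'n ^ 'n. invertible P \<and> (\<forall>A\<in>\<C>. diagonal_matrix (transpose P ** A ** P)))"

definition real_similarly_diagonalizable :: "real ^ 'n ^ 'n \<Rightarrow> bool" where
  "real_similarly_diagonalizable M \<longleftrightarrow>
    (\<exists>H :: real ^ 'n ^ 'n. invertible H \<and> diagonal_matrix (matrix_inv H ** M ** H))"

end

theory Submission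
  imports Defs
begin

text \<open>
  Write \<open>S\<close> for the invertible member \<open>C 1\<close>. It defines a nondegenerate symmetric bilinear form
  \<open>B x y = x \<bullet> (S *v y)\<close>, in general indefinite.

  If \<open>P\<close> diagonalizes all the matrices by congruence, then \<open>P\<close> also diagonalizes each
  \<open>matrix_inv S ** A\<close> by similarity, the result being a quotient of two diagonal matrices. Moreover
  \<open>X ** matrix_inv S ** A\<close> is congruent to a product of diagonal matrices, hence symmetric.

  For the converse, symmetry of \<open>X ** matrix_inv S ** A\<close> says exactly that \<open>matrix_inv S ** A\<close> and
  \<open>matrix_inv S ** X\<close> commute. Commuting diagonalizable matrices have enough joint eigenvectors to
  span the space (lemma \<open>span_joint_eigenvectors\<close>). All the \<open>matrix_inv S ** A\<close> are self-adjoint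
  for \<open>B\<close>, because \<open>A\<close> is symmetric, and so joint eigenvectors with different eigenvalues are
  \<open>B\<close>-orthogonal. This allows a Gram-Schmidt type argument inside the set of joint eigenvectors
  (lemma \<open>orthogonal_joint_eigenbasis\<close>), giving a \<open>B\<close>-orthogonal basis of joint eigenvectors. With
  these as columns of \<open>P\<close>, an entry of \<open>transpose P ** A ** P\<close> is an eigenvalue times a value of
  \<open>B\<close> on two basis vectors, and therefore vanishes off the diagonal.
\<close>

section \<open>Symmetric and diagonal matrices\<close>

lemma matrix_inv_right_left:
  fixes A :: "'a::semiring_1 ^ 'n ^ 'n"
  assumes "invertible A"
  shows "A ** matrix_inv A = mat 1" "matrix_inv A ** A = mat 1"
  using someI_ex[OF assms[unfolded invertible_def]] unfolding matrix_inv_def by blast+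

lemma inner_symmetric_matrix:
  fixes S :: "real ^ 'n ^ 'n"
  assumes "symmetric_matrix S"
  shows "x \<bullet> (S *v y) = y \<bullet> (S *v x)"
  using assms unfolding symmetric_matrix_def
  by (metis dot_lmul_matrix inner_commute transpose_matrix_vector)

lemma symmetric_matrix_inv:
  fixes S :: "'a::comm_semiring_1 ^ 'n ^ 'n"
  assumes "invertible S" "symmetric_matrix S"
  shows "symmetric_matrix (matrix_inv S)"
proof -
  define T where "T = matrix_inv S"
  have ST: "S ** T = mat 1"
    unfolding T_def using assms(1) by (rule matrix_inv_right_left)
  have "transpose T ** S = transpose (S ** T)"
    using assms(2) by (simp add: matrix_transpose_mul symmetric_matrix_def)
  hence "transpose T ** S = mat 1" by (simp add: ST)
  hence "transpose T ** S ** T = T" by simp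
  hence "transpose T ** (S ** T) = T" by (simp add: matrix_mul_assoc)
  hence "transpose T = T" by (simp add: ST)
  thus ?thesis by (simp add: T_def symmetric_matrix_def)
qed

lemma symmetric_matrix_congruence_iff:
  fixes A P :: "real ^ 'n ^ 'n"
  assumes "invertible P"
  shows "symmetric_matrix (transpose P ** A ** P) \<longleftrightarrow> symmetric_matrix A"
proof -
  define Q where "Q = matrix_inv P"
  have PQ: "P ** Q = mat 1"
    unfolding Q_def using assms by (rule matrix_inv_right_left)
  have "transpose Q ** transpose P = transpose (P ** Q)"
    by (rule matrix_transpose_mul[symmetric])
  hence PQ': "transpose Q ** transpose P = mat 1"
    by (simp add: PQ)
  have cancel: "transpose Q ** (transpose P ** B ** P) ** Q = B" for B
  proof -
    have "transpose Q ** (transpose P ** B ** P) ** Q = (transpose Q ** transpose P) ** B ** (P ** Q)"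
      by (simp only: matrix_mul_assoc)
    thus ?thesis by (simp add: PQ PQ')
  qed
  have "transpose (transpose P ** A ** P) = transpose P ** transpose A ** P"
    by (simp add: matrix_transpose_mul matrix_mul_assoc)
  thus ?thesis
    using cancel[of A] cancel[of "transpose A"] unfolding symmetric_matrix_def by auto
qed

lemma diagonal_matrix_mult_left:
  fixes D A :: "'a::semiring_1 ^ 'n ^ 'n"
  assumes "diagonal_matrix D"
  shows "(D ** A) $ i $ j = D $ i $ i * A $ i $ j"
proof -
  have "(D ** A) $ i $ j = (\<Sum>k\<in>UNIV. if k = i then D $ i $ i * A $ i $ j else 0)"
    unfolding matrix_matrix_mult_def vec_lambda_beta
    using assms by (intro sum.cong) (auto simp: diagonal_matrix_def)
  thus ?thesis by simp
qed

lemma diagonal_matrix_mult_right: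
  fixes D A :: "'a::semiring_1 ^ 'n ^ 'n"
  assumes "diagonal_matrix D"
  shows "(A ** D) $ i $ j = A $ i $ j * D $ j $ j"
proof -
  have "(A ** D) $ i $ j = (\<Sum>k\<in>UNIV. if k = j then A $ i $ j * D $ j $ j else 0)"
    unfolding matrix_matrix_mult_def vec_lambda_beta
    using assms by (intro sum.cong) (auto simp: diagonal_matrix_def)
  thus ?thesis by simp
qed

lemma diagonal_matrix_vector_mult:
  fixes D :: "'a::semiring_1 ^ 'n ^ 'n"
  assumes "diagonal_matrix D"
  shows "(D *v x) $ i = D $ i $ i * x $ i"
proof -
  have "(D *v x) $ i = (\<Sum>k\<in>UNIV. if k = i then D $ i $ i * x $ i else 0)"
    unfolding matrix_vector_mult_def vec_lambda_beta
    using assms by (intro sum.cong) (auto simp: diagonal_matrix_def)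
  thus ?thesis by simp
qed

lemma diagonal_matrix_mult:
  fixes D E :: "'a::semiring_1 ^ 'n ^ 'n"
  assumes "diagonal_matrix D" "diagonal_matrix E"
  shows "diagonal_matrix (D ** E)"
  using assms unfolding diagonal_matrix_def
  by (simp add: diagonal_matrix_mult_left[OF assms(1)])

lemma symmetric_matrix_if_diagonal:
  "diagonal_matrix D \<Longrightarrow> symmetric_matrix D"
  unfolding diagonal_matrix_def symmetric_matrix_def transpose_def vec_eq_iff
  by simp metis

lemma diagonal_matrix_inverse:
  fixes D :: "real ^ 'n ^ 'n"
  assumes "diagonal_matrix D" "D ** E = mat 1"
  shows "diagonal_matrix E"
  unfolding diagonal_matrix_def
proof (intro allI impI)
  fix i j :: 'n assume "i \<noteq> j"
  note entry = diagonal_matrix_mult_left[OF assms(1), of E i]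
  from entry[of i] entry[of j] \<open>i \<noteq> j\<close> show "E $ i $ j = 0"
    by (auto simp: assms(2) mat_def)
qed

section \<open>Necessity\<close>

text \<open>
  Let \<open>P\<close> realize the congruence. The inverse of \<open>transpose P ** S ** P\<close> is
  \<open>E = matrix_inv P ** matrix_inv S ** transpose (matrix_inv P)\<close>, again diagonal. Placing \<open>E\<close> next to
  \<open>transpose P ** A ** P\<close>, the inner factors cancel and a similarity by \<open>P\<close> remains.
\<close>

lemma SDC_imp_diagonalizable_symmetric:
  fixes S :: "real ^ 'n ^ 'n"
  assumes "invertible S" "SDC \<C>" "S \<in> \<C>" "A \<in> \<C>" "B \<in> \<C>"
  shows "real_similarly_diagonalizable (matrix_inv S ** A)"
    and "symmetric_matrix (B ** matrix_inv S ** A)"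
proof -
  obtain P :: "real ^ 'n ^ 'n" where P: "invertible P"
    and diag: "\<And>X. X \<in> \<C> \<Longrightarrow> diagonal_matrix (transpose P ** X ** P)"
    using assms(2) unfolding SDC_def by blast
  define Q where "Q = matrix_inv P"
  define T where "T = matrix_inv S"
  have PQ: "P ** Q = mat 1" "Q ** P = mat 1"
    using P by (simp_all add: Q_def matrix_inv_right_left)
  have PQ': "transpose P ** transpose Q = mat 1" "transpose Q ** transpose P = mat 1"
    using PQ by (simp_all flip: matrix_transpose_mul)
  have ST: "S ** T = mat 1" "T ** S = mat 1"
    using assms(1) by (simp_all add: T_def matrix_inv_right_left)
  define E where "E = Q ** T ** transpose Q"
  have "(transpose P ** S ** P) ** E = transpose P ** (S ** ((P ** Q) ** T)) ** transpose Q"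
    by (simp add: E_def matrix_mul_assoc)
  also have "\<dots> = mat 1"
    by (simp add: PQ ST PQ')
  finally have E: "diagonal_matrix E"
    using diag[OF assms(3)] diagonal_matrix_inverse by blast
  have "E ** (transpose P ** A ** P) = Q ** T ** (transpose Q ** transpose P) ** A ** P"
    by (simp add: E_def matrix_mul_assoc)
  hence EA: "E ** (transpose P ** A ** P) = Q ** (T ** A) ** P"
    by (simp add: PQ' matrix_mul_assoc)
  have "diagonal_matrix (Q ** (T ** A) ** P)"
    unfolding EA[symmetric] using E diag[OF assms(4)] by (rule diagonal_matrix_mult)
  thus "real_similarly_diagonalizable (matrix_inv S ** A)"
    using P unfolding real_similarly_diagonalizable_def Q_def T_def by blast
  have "(transpose P ** B ** P) ** (Q ** (T ** A) ** P)
      = transpose P ** B ** (P ** Q) ** T ** A ** P"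
    by (simp add: matrix_mul_assoc)
  also have "\<dots> = transpose P ** (B ** T ** A) ** P"
    by (simp add: PQ matrix_mul_assoc)
  finally have "diagonal_matrix (transpose P ** (B ** T ** A) ** P)"
    using diagonal_matrix_mult[OF diag[OF assms(5)] \<open>diagonal_matrix (Q ** (T ** A) ** P)\<close>]
    by simp
  thus "symmetric_matrix (B ** matrix_inv S ** A)"
    using symmetric_matrix_if_diagonal symmetric_matrix_congruence_iff[OF P]
    unfolding T_def by blast
qed

section \<open>Joint eigenvectors of commuting diagonalizable matrices\<close>

text \<open>
  The eigenvalue may depend on the matrix. The zero vector is included, so that images of joint
  eigenvectors under maps commuting with all the matrices are again in the set.
\<close>

definition joint_eigenvectors :: "(real ^ 'n ^ 'n) set \<Rightarrow> (real ^ 'n) set" where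
  "joint_eigenvectors \<M> = {x. \<forall>A\<in>\<M>. \<exists>c. A *v x = c *\<^sub>R x}"

text \<open>
  The \<open>E \<mu>\<close> are the spectral projections. In coordinates where \<open>M\<close> is a diagonal matrix \<open>D\<close>, they
  pick the positions at which \<open>D\<close> has entry \<open>\<mu>\<close>. A matrix commuting with \<open>D\<close> can only have nonzero
  entries between positions with equal entries of \<open>D\<close>; it is block diagonal and so commutes with
  the \<open>E \<mu>\<close>.
\<close>

lemma spectral_decomposition:
  fixes M :: "real ^ 'n ^ 'n"
  assumes "real_similarly_diagonalizable M"
  obtains \<Lambda> :: "real set" and E :: "real \<Rightarrow> real ^ 'n ^ 'n"
  where "finite \<Lambda>"
    and "\<And>x. (\<Sum>\<mu>\<in>\<Lambda>. E \<mu> *v x) = x"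
    and "\<And>\<mu> x. M *v (E \<mu> *v x) = \<mu> *\<^sub>R (E \<mu> *v x)"
    and "\<And>A \<mu>. A ** M = M ** A \<Longrightarrow> A ** E \<mu> = E \<mu> ** A"
proof -
  obtain H :: "real ^ 'n ^ 'n" where H: "invertible H" and diag: "diagonal_matrix (matrix_inv H ** M ** H)"
    using assms unfolding real_similarly_diagonalizable_def by blast
  define G where "G = matrix_inv H"
  define D where "D = G ** M ** H"
  have HG: "H ** G = mat 1" "G ** H = mat 1"
    using H by (simp_all add: G_def matrix_inv_right_left)
  have D: "diagonal_matrix D"
    using diag by (simp add: D_def G_def)
  define I where "I \<mu> = (\<chi> i j. if i = j \<and> D $ i $ i = \<mu> then 1 else (0 :: real))" for \<mu>
  define E where "E \<mu> = H ** I \<mu> ** G" for \<mu>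
  define \<Lambda> where "\<Lambda> = range (\<lambda>i. D $ i $ i)"
  have fin: "finite \<Lambda>" by (simp add: \<Lambda>_def)
  have I: "diagonal_matrix (I \<mu>)" for \<mu>
    by (simp add: I_def diagonal_matrix_def)
  have Iv: "(I \<mu> *v y) $ i = (if D $ i $ i = \<mu> then y $ i else 0)" for \<mu> y i
    unfolding diagonal_matrix_vector_mult[OF I] by (simp add: I_def)
  have total: "(\<Sum>\<mu>\<in>\<Lambda>. I \<mu> *v y) = y" for y
    unfolding vec_eq_iff by (simp add: Iv \<Lambda>_def)
  have eig: "D *v (I \<mu> *v y) = \<mu> *\<^sub>R (I \<mu> *v y)" for \<mu> y
    by (simp add: vec_eq_iff Iv diagonal_matrix_vector_mult[OF D])
  have MD: "M = H ** D ** G"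
  proof -
    have "H ** D ** G = (H ** G) ** M ** (H ** G)"
      by (simp add: D_def matrix_mul_assoc)
    thus ?thesis by (simp add: HG)
  qed
  show ?thesis
  proof (rule that[OF fin])
    fix x
    have "(\<Sum>\<mu>\<in>\<Lambda>. E \<mu> *v x) = H *v (\<Sum>\<mu>\<in>\<Lambda>. I \<mu> *v (G *v x))"
      by (simp add: E_def matrix_vector_mul_assoc[symmetric] linear_sum[OF matrix_vector_mul_linear])
    also have "\<dots> = x" unfolding total by (simp add: matrix_vector_mul_assoc HG)
    finally show "(\<Sum>\<mu>\<in>\<Lambda>. E \<mu> *v x) = x" .
  next
    fix \<mu> x
    have "M *v (E \<mu> *v x) = H *v (D *v ((G ** H) *v (I \<mu> *v (G *v x))))"
      by (simp add: E_def MD matrix_vector_mul_assoc matrix_mul_assoc)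
    also have "\<dots> = \<mu> *\<^sub>R (H *v (I \<mu> *v (G *v x)))"
      by (simp add: HG eig matrix_vector_mult_scaleR)
    finally show "M *v (E \<mu> *v x) = \<mu> *\<^sub>R (E \<mu> *v x)"
      by (simp add: E_def matrix_vector_mul_assoc matrix_mul_assoc)
  next
    fix A \<mu> assume comm: "A ** M = M ** A"
    \<comment> \<open>\<open>K\<close> is \<open>A\<close> in the eigenbasis of \<open>M\<close>; it commutes with \<open>D\<close>.\<close>
    define K where "K = G ** A ** H"
    have "K ** D = G ** A ** (H ** G) ** M ** H"
      by (simp add: K_def D_def matrix_mul_assoc)
    also have "\<dots> = G ** (A ** M) ** H"
      by (simp add: HG matrix_mul_assoc)
    also have "\<dots> = G ** M ** (H ** G) ** A ** H"
      unfolding comm by (simp add: HG matrix_mul_assoc)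
    also have "\<dots> = D ** K"
      by (simp add: K_def D_def matrix_mul_assoc)
    finally have "K ** D = D ** K" .
    hence block: "K $ i $ j * D $ j $ j = D $ i $ i * K $ i $ j" for i j
      by (metis diagonal_matrix_mult_left[OF D] diagonal_matrix_mult_right[OF D])
    have "(K ** I \<mu>) $ i $ j = (I \<mu> ** K) $ i $ j" for i j
      unfolding diagonal_matrix_mult_left[OF I] diagonal_matrix_mult_right[OF I]
      using block[of i j] by (auto simp: I_def)
    hence KI: "K ** I \<mu> = I \<mu> ** K" by (simp add: vec_eq_iff)
    have "A ** E \<mu> = (H ** G) ** A ** H ** I \<mu> ** G"
      by (simp add: HG E_def matrix_mul_assoc)
    also have "\<dots> = H ** (K ** I \<mu>) ** G"
      by (simp add: K_def matrix_mul_assoc)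
    also have "\<dots> = H ** I \<mu> ** G ** A ** (H ** G)"
      unfolding KI by (simp add: K_def matrix_mul_assoc)
    finally show "A ** E \<mu> = E \<mu> ** A"
      by (simp add: HG E_def)
  qed
qed

text \<open>
  By induction, it is enough to split a joint eigenvector \<open>x\<close> of the previous matrices into joint
  eigenvectors that are also eigenvectors of one further matrix \<open>M\<close>. The components \<open>E \<mu> *v x\<close> serve:
  the spectral projections of \<open>M\<close> commute with the previous matrices, so each component keeps the
  eigenvalues of \<open>x\<close>.
\<close>

lemma span_joint_eigenvectors:
  fixes \<M> :: "(real ^ 'n ^ 'n) set"
  assumes "finite \<M>"
    and "\<And>A. A \<in> \<M> \<Longrightarrow> real_similarly_diagonalizable A"
    and "\<And>A B. A \<in> \<M> \<Longrightarrow> B \<in> \<M> \<Longrightarrow> A ** B = B ** A"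
  shows "span (joint_eigenvectors \<M>) = UNIV"
  using assms
proof (induction \<M> rule: finite_induct)
  case empty
  show ?case by (simp add: joint_eigenvectors_def)
next
  case (insert M \<M>)
  obtain \<Lambda> E where E: "finite \<Lambda>"
      "\<And>x. (\<Sum>\<mu>\<in>\<Lambda>. E \<mu> *v x) = x"
      "\<And>\<mu> x. M *v (E \<mu> *v x) = \<mu> *\<^sub>R (E \<mu> *v x)"
      "\<And>A \<mu>. A ** M = M ** A \<Longrightarrow> A ** E \<mu> = E \<mu> ** A"
    using spectral_decomposition[of M] insert.prems(1) by (metis insertI1)
  have "x \<in> span (joint_eigenvectors (insert M \<M>))" if x: "x \<in> joint_eigenvectors \<M>" for x
  proof -
    have "E \<mu> *v x \<in> joint_eigenvectors (insert M \<M>)" for \<mu>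
    proof -
      have "\<exists>c. A *v (E \<mu> *v x) = c *\<^sub>R (E \<mu> *v x)" if A: "A \<in> \<M>" for A
      proof -
        obtain c where "A *v x = c *\<^sub>R x"
          using x A by (auto simp: joint_eigenvectors_def)
        moreover have "A ** E \<mu> = E \<mu> ** A"
          using insert.prems(2) A by (intro E(4)) blast
        ultimately have "A *v (E \<mu> *v x) = c *\<^sub>R (E \<mu> *v x)"
          by (metis matrix_vector_mul_assoc matrix_vector_mult_scaleR)
        thus ?thesis ..
      qed
      thus ?thesis using E(3) by (auto simp: joint_eigenvectors_def)
    qed
    hence "(\<Sum>\<mu>\<in>\<Lambda>. E \<mu> *v x) \<in> span (joint_eigenvectors (insert M \<M>))"
      by (intro span_sum span_base)
    thus ?thesis by (simp add: E(2))
  qed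
  moreover have "span (joint_eigenvectors \<M>) = UNIV"
    using insert.prems by (intro insert.IH) blast+
  ultimately show ?case
    by (metis span_minimal subset_eq subspace_span top.extremum_unique)
qed

section \<open>Orthogonalization for an indefinite form\<close>

text \<open>
  Isotropic vectors have to be excluded explicitly, as the form need not be definite; without them,
  orthogonality still forces independence.
\<close>

definition orthogonal_frame :: "real ^ 'n ^ 'n \<Rightarrow> (real ^ 'n) set \<Rightarrow> bool" where
  "orthogonal_frame S V \<longleftrightarrow>
    (\<forall>v\<in>V. v \<bullet> (S *v v) \<noteq> 0) \<and> (\<forall>v\<in>V. \<forall>w\<in>V. v \<noteq> w \<longrightarrow> v \<bullet> (S *v w) = 0)"

lemma inner_sum_orthogonal_frame:
  fixes S :: "real ^ 'n ^ 'n"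
  assumes "orthogonal_frame S V" "finite V" "v \<in> V"
  shows "v \<bullet> (S *v (\<Sum>w\<in>V. a w *\<^sub>R w)) = a v * (v \<bullet> (S *v v))"
proof -
  have "v \<bullet> (S *v (\<Sum>w\<in>V. a w *\<^sub>R w)) = (\<Sum>w\<in>V. a w * (v \<bullet> (S *v w)))"
    by (simp add: linear_sum[OF matrix_vector_mul_linear] inner_sum_right matrix_vector_mult_scaleR)
  also have "\<dots> = (\<Sum>w\<in>V. if w = v then a v * (v \<bullet> (S *v v)) else 0)"
    using assms by (intro sum.cong) (auto simp: orthogonal_frame_def)
  finally show ?thesis using assms by simp
qed

lemma independent_orthogonal_frame:
  fixes S :: "real ^ 'n ^ 'n"
  assumes "orthogonal_frame S V"
  shows "independent V"
proof
  assume "dependent V"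
  then obtain U a v where U: "finite U" "U \<subseteq> V" "v \<in> U" "a v \<noteq> 0" "(\<Sum>w\<in>U. a w *\<^sub>R w) = 0"
    unfolding dependent_explicit by blast
  moreover have "orthogonal_frame S U"
    using assms U(2) unfolding orthogonal_frame_def by blast
  ultimately show False
    using inner_sum_orthogonal_frame[of S U v a] by (auto simp: orthogonal_frame_def)
qed

text \<open>
  Take an orthogonal frame \<open>V\<close> of joint eigenvectors of maximal size, and let \<open>\<pi>\<close> be the projection
  onto its \<open>B\<close>-orthogonal complement. Self-adjointness makes \<open>\<pi>\<close> preserve joint eigenvectors. By
  maximality, \<open>B u u = 0\<close> for every joint eigenvector \<open>u\<close> in the complement, and then \<open>B\<close> vanishes
  on any two of them: if some eigenvalues differ, by self-adjointness; otherwise their sum is again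
  such a vector, and polarization applies. So \<open>\<pi> u\<close> is \<open>B\<close>-orthogonal to \<open>V\<close> and to every
  \<open>\<pi> x\<close>, hence to all joint eigenvectors \<open>x\<close>. These span the space, and nondegeneracy gives
  \<open>\<pi> u = 0\<close>, that is, \<open>u \<in> span V\<close>.
\<close>

lemma orthogonal_joint_eigenbasis:
  fixes S :: "real ^ 'n ^ 'n"
  assumes S: "invertible S" "symmetric_matrix S"
    and selfadj: "\<And>A. A \<in> \<M> \<Longrightarrow> symmetric_matrix (S ** A)"
    and full: "span (joint_eigenvectors \<M>) = UNIV"
  obtains V where "orthogonal_frame S V" "V \<subseteq> joint_eigenvectors \<M>" "span V = UNIV"
proof -
  let ?B = "\<lambda>x y. x \<bullet> (S *v y)"
  let ?ok = "\<lambda>V. orthogonal_frame S V \<and> V \<subseteq> joint_eigenvectors \<M>"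
  have sym: "?B x y = ?B y x" for x y
    using inner_symmetric_matrix[OF S(2)] .
  have adj: "?B x (A *v y) = ?B (A *v x) y" if "A \<in> \<M>" for A x y
    using inner_symmetric_matrix[OF selfadj[OF that], of x y] sym
    by (simp add: matrix_vector_mul_assoc)
  have card: "finite V \<and> card V \<le> CARD('n)" if "?ok V" for V
    using independent_bound[OF independent_orthogonal_frame] that by fastforce
  have "?ok {}" by (simp add: orthogonal_frame_def)
  then obtain V where V: "?ok V" and max: "\<And>W. ?ok W \<Longrightarrow> card W \<le> card V"
    using ex_has_greatest_nat[of ?ok "{}" card "Suc CARD('n)"] card
    by (auto simp: less_Suc_eq_le)
  have finV: "finite V" using card V by blast
  define \<pi> where "\<pi> x = x - (\<Sum>v\<in>V. (?B v x / ?B v v) *\<^sub>R v)" for x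
  have perp: "?B v (\<pi> x) = 0" if "v \<in> V" for v x
    using inner_sum_orthogonal_frame[of S V v "\<lambda>v. ?B v x / ?B v v"] V finV that
    by (simp add: \<pi>_def matrix_vector_mult_diff_distrib inner_diff_right orthogonal_frame_def)
  have \<pi>_eigen: "A *v \<pi> x = c *\<^sub>R \<pi> x" if A: "A \<in> \<M>" and x: "A *v x = c *\<^sub>R x" for A c x
  proof -
    have "A *v ((?B v x / ?B v v) *\<^sub>R v) = c *\<^sub>R ((?B v x / ?B v v) *\<^sub>R v)" if v: "v \<in> V" for v
    proof -
      obtain a where a: "A *v v = a *\<^sub>R v"
        using V v A unfolding joint_eigenvectors_def by blast
      have "a * ?B v x = c * ?B v x"
        using adj[OF A, of v x] by (auto simp: a x matrix_vector_mult_scaleR)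
      thus ?thesis by (auto simp: matrix_vector_mult_scaleR a)
    qed
    thus ?thesis
      by (simp add: \<pi>_def matrix_vector_mult_diff_distrib x scaleR_diff_right scaleR_sum_right
          linear_sum[OF matrix_vector_mul_linear])
  qed
  have \<pi>_joint: "\<pi> x \<in> joint_eigenvectors \<M>" if "x \<in> joint_eigenvectors \<M>" for x
    using that \<pi>_eigen unfolding joint_eigenvectors_def by blast
  have isotropic: "?B u u = 0"
    if u: "u \<in> joint_eigenvectors \<M>" "\<And>v. v \<in> V \<Longrightarrow> ?B v u = 0" for u
  proof (rule ccontr)
    assume ne: "?B u u \<noteq> 0"
    have "?ok (insert u V)"
      using V u ne sym by (auto simp: orthogonal_frame_def)
    moreover have "u \<notin> V" using u(2) ne by blast
    ultimately show False using max[of "insert u V"] finV by simp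
  qed
  have zero: "?B u w = 0"
    if u: "u \<in> joint_eigenvectors \<M>" "\<And>v. v \<in> V \<Longrightarrow> ?B v u = 0"
      and w: "w \<in> joint_eigenvectors \<M>" "\<And>v. v \<in> V \<Longrightarrow> ?B v w = 0" for u w
  proof (cases "\<exists>A\<in>\<M>. \<exists>c d. A *v u = c *\<^sub>R u \<and> A *v w = d *\<^sub>R w \<and> c \<noteq> d")
    case True
    then obtain A c d where A: "A \<in> \<M>" "A *v u = c *\<^sub>R u" "A *v w = d *\<^sub>R w" "c \<noteq> d"
      by blast
    have "d * ?B u w = c * ?B u w"
      using adj[OF A(1), of u w] by (simp add: A matrix_vector_mult_scaleR)
    thus ?thesis using A(4) by simp
  next
    case False
    have "\<exists>c. A *v (u + w) = c *\<^sub>R (u + w)" if A: "A \<in> \<M>" for A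
    proof -
      obtain c d where "A *v u = c *\<^sub>R u" "A *v w = d *\<^sub>R w"
        using u(1) w(1) A unfolding joint_eigenvectors_def by blast
      moreover from this have "c = d" using False A by blast
      ultimately show ?thesis
        by (metis matrix_vector_right_distrib scaleR_add_right)
    qed
    hence "u + w \<in> joint_eigenvectors \<M>" by (simp add: joint_eigenvectors_def)
    hence "?B (u + w) (u + w) = 0"
      using u(2) w(2) by (intro isotropic) (auto simp: matrix_vector_right_distrib inner_add_right)
    thus ?thesis
      using isotropic[OF u] isotropic[OF w] sym[of u w]
      by (simp add: matrix_vector_right_distrib inner_add_left inner_add_right)
  qed
  have "u \<in> span V" if u: "u \<in> joint_eigenvectors \<M>" for u
  proof -
    have "?B (\<pi> u) x = 0" if "x \<in> joint_eigenvectors \<M>" for x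
    proof -
      have "?B (\<pi> u) (\<Sum>v\<in>V. (?B v x / ?B v v) *\<^sub>R v) = 0"
        using perp sym
        by (simp add: linear_sum[OF matrix_vector_mul_linear] inner_sum_right
            matrix_vector_mult_scaleR)
      moreover have "?B (\<pi> u) (\<pi> x) = 0"
        using zero \<pi>_joint u that perp by blast
      ultimately show ?thesis
        by (simp add: \<pi>_def[of x] matrix_vector_mult_diff_distrib inner_diff_right)
    qed
    moreover have "subspace {x. ?B (\<pi> u) x = 0}"
      by (auto simp: subspace_def matrix_vector_right_distrib inner_add_right
          matrix_vector_mult_scaleR)
    ultimately have "span (joint_eigenvectors \<M>) \<subseteq> {x. ?B (\<pi> u) x = 0}"
      by (intro span_minimal) auto
    hence B0: "?B (\<pi> u) x = 0" for x
      using full by blast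
    have "S *v (matrix_inv S *v \<pi> u) = \<pi> u"
      using S(1) by (simp add: matrix_vector_mul_assoc matrix_inv_right_left)
    hence "\<pi> u = 0"
      using B0[of "matrix_inv S *v \<pi> u"] by simp
    hence "u = (\<Sum>v\<in>V. (?B v u / ?B v v) *\<^sub>R v)"
      by (simp add: \<pi>_def)
    also have "\<dots> \<in> span V"
      by (intro span_sum span_scale span_base)
    finally show ?thesis .
  qed
  hence "span V = UNIV"
    using full by (metis span_minimal subset_eq subspace_span top.extremum_unique)
  thus ?thesis using that V by blast
qed

section \<open>Sufficiency and the equivalence\<close>

text \<open>
  Injectivity makes distinct column indices refer to distinct basis vectors, to which orthogonality
  in the sense of \<open>orthogonal_frame\<close> applies.
\<close>

lemma matrix_of_basis:
  fixes V :: "(real ^ 'n) set"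
  assumes "independent V" "span V = UNIV"
  obtains P :: "real ^ 'n ^ 'n" where "invertible P" "inj (\<lambda>j. column j P)" "\<And>j. column j P \<in> V"
proof -
  have fin: "finite V" using assms(1) independent_bound by blast
  have "card V = dim (UNIV :: (real ^ 'n) set)"
    using assms by (intro basis_card_eq_dim) simp_all
  hence "card V = CARD('n)" by simp
  then obtain f :: "'n \<Rightarrow> real ^ 'n" where f: "bij_betw f UNIV V"
    using finite_same_card_bij[of "UNIV :: 'n set" V] fin by auto
  define P where "P = (\<chi> i j. f j $ i)"
  have col: "column j P = f j" for j
    by (simp add: P_def column_def vec_eq_iff)
  have "columns P = V"
    using f unfolding columns_def col by (auto simp: bij_betw_def)
  hence "invertible P"
    using assms(2) matrix_right_invertible_span_columns[of P] invertible_right_inverse[of P]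
    by (simp add: span_vec_eq)
  thus ?thesis
    using f col by (intro that[of P]) (auto simp: bij_betw_def)
qed

text \<open>
  Transposing \<open>B ** matrix_inv S ** A\<close> reverses the order of its symmetric factors, so its symmetry
  is the commutation of \<open>matrix_inv S ** A\<close> with \<open>matrix_inv S ** B\<close>. The columns of the congruence
  matrix form an \<open>S\<close>-orthogonal basis of joint eigenvectors.
\<close>

lemma SDC_if_diagonalizable_commuting:
  fixes S :: "real ^ 'n ^ 'n"
  assumes S: "invertible S" "symmetric_matrix S"
    and fin: "finite \<C>"
    and sym: "\<And>A. A \<in> \<C> \<Longrightarrow> symmetric_matrix A"
    and diag: "\<And>A. A \<in> \<C> \<Longrightarrow> real_similarly_diagonalizable (matrix_inv S ** A)"
    and prod: "\<And>A B. A \<in> \<C> \<Longrightarrow> B \<in> \<C> \<Longrightarrow> symmetric_matrix (B ** matrix_inv S ** A)"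
  shows "SDC (insert S \<C>)"
proof -
  define T where "T = matrix_inv S"
  define \<M> where "\<M> = (\<lambda>A. T ** A) ` \<C>"
  have ST: "S ** T = mat 1" "T ** S = mat 1"
    using S(1) by (simp_all add: T_def matrix_inv_right_left)
  have T: "transpose T = T"
    using symmetric_matrix_inv[OF S] by (simp add: T_def symmetric_matrix_def)
  have swap: "B ** T ** A = A ** T ** B" if "A \<in> \<C>" "B \<in> \<C>" for A B
    using prod[OF that] sym that T
    by (simp add: symmetric_matrix_def matrix_transpose_mul matrix_mul_assoc flip: T_def)
  have comm: "X ** Y = Y ** X" if "X \<in> \<M>" "Y \<in> \<M>" for X Y
  proof -
    obtain A B where AB: "A \<in> \<C>" "B \<in> \<C>" "X = T ** A" "Y = T ** B"
      using \<open>X \<in> \<M>\<close> \<open>Y \<in> \<M>\<close> unfolding \<M>_def by blast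
    have "X ** Y = T ** (A ** T ** B)" "Y ** X = T ** (B ** T ** A)"
      unfolding AB by (simp_all add: matrix_mul_assoc)
    thus ?thesis using swap[OF AB(1,2)] by simp
  qed
  have STA: "S ** (T ** A) = A" for A :: "real ^ 'n ^ 'n"
    by (simp add: matrix_mul_assoc ST)
  have "span (joint_eigenvectors \<M>) = UNIV"
  proof (rule span_joint_eigenvectors)
    show "finite \<M>" using fin by (simp add: \<M>_def)
    show "real_similarly_diagonalizable X" if "X \<in> \<M>" for X
      using that diag unfolding \<M>_def T_def by blast
  qed (rule comm)
  moreover have selfadj: "symmetric_matrix (S ** X)" if "X \<in> \<M>" for X
    using that sym unfolding \<M>_def by (auto simp: STA)
  ultimately obtain V where V: "orthogonal_frame S V" "V \<subseteq> joint_eigenvectors \<M>" "span V = UNIV"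
    using orthogonal_joint_eigenbasis[OF S selfadj] by blast
  obtain P :: "real ^ 'n ^ 'n"
    where P: "invertible P" "inj (\<lambda>j. column j P)" "\<And>j. column j P \<in> V"
    using matrix_of_basis[OF independent_orthogonal_frame[OF V(1)] V(3)] by blast
  have entry: "(transpose P ** A ** P) $ i $ j = column i P \<bullet> (A *v column j P)"
    for A :: "real ^ 'n ^ 'n" and i j
  proof -
    have "(transpose P ** A ** P) $ i $ j = (transpose P ** (A ** P)) $ i $ j"
      by (simp add: matrix_mul_assoc)
    also have "\<dots> = column i P \<bullet> column j (A ** P)"
      by (simp add: matrix_matrix_mult_def transpose_def column_def inner_vec_def)
    also have "column j (A ** P) = A *v column j P"
      by (simp add: matrix_matrix_mult_def matrix_vector_mult_def column_def)
    finally show ?thesis .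
  qed
  have orth: "column i P \<bullet> (S *v column j P) = 0" if "i \<noteq> j" for i j
    using V(1) P(2,3) that unfolding orthogonal_frame_def by (metis injD)
  have "diagonal_matrix (transpose P ** S ** P)"
    unfolding diagonal_matrix_def entry using orth by blast
  moreover have "diagonal_matrix (transpose P ** A ** P)" if A: "A \<in> \<C>" for A
    unfolding diagonal_matrix_def entry
  proof (intro allI impI)
    fix i j :: 'n assume "i \<noteq> j"
    have "column j P \<in> joint_eigenvectors \<M>" using P(3) V(2) by blast
    then obtain c where c: "(T ** A) *v column j P = c *\<^sub>R column j P"
      using A unfolding joint_eigenvectors_def \<M>_def by blast
    have "A *v column j P = c *\<^sub>R (S *v column j P)"
      by (metis STA c matrix_vector_mul_assoc matrix_vector_mult_scaleR)
    thus "column i P \<bullet> (A *v column j P) = 0"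
      using orth[OF \<open>i \<noteq> j\<close>] by simp
  qed
  ultimately show ?thesis using P(1) unfolding SDC_def by blast
qed

text \<open>
  The symmetry hypothesis covers only pairs \<open>i < j\<close>. Transposition exchanges \<open>i\<close> and \<open>j\<close>, which gives
  the pairs \<open>i > j\<close>, and for \<open>i = j\<close> the matrix equals its own transpose.
\<close>

theorem theorem2:
  fixes m :: nat and C :: "nat \<Rightarrow> real ^ 'n ^ 'n"
  assumes "m \<ge> 3"
    and "\<And>i. i \<in> {1..m} \<Longrightarrow> symmetric_matrix (C i)"
    and "invertible (C 1)"
  shows "SDC (C ` {1..m}) \<longleftrightarrow>
    (\<forall>i\<in>{2..m}. real_similarly_diagonalizable (matrix_inv (C 1) ** C i)) \<and>
    (\<forall>i j. 2 \<le> i \<and> i < j \<and> j \<le> m \<longrightarrow> symmetric_matrix (C j ** matrix_inv (C 1) ** C i))"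
    (is "?sdc \<longleftrightarrow> ?diag \<and> ?sym")
proof
  assume ?sdc
  have C1: "C 1 \<in> C ` {1..m}" using assms(1) by simp
  note * = SDC_imp_diagonalizable_symmetric[OF assms(3) \<open>?sdc\<close> C1]
  have mem: "C i \<in> C ` {1..m}" if "2 \<le> i" "i \<le> m" for i using that by (intro imageI) simp
  show "?diag \<and> ?sym"
  proof (intro conjI ballI allI impI)
    fix i assume "i \<in> {2..m}"
    hence "C i \<in> C ` {1..m}" using mem by simp
    thus "real_similarly_diagonalizable (matrix_inv (C 1) ** C i)"
      using C1 by (rule *(1))
  next
    fix i j assume "2 \<le> i \<and> i < j \<and> j \<le> m"
    hence "C i \<in> C ` {1..m}" "C j \<in> C ` {1..m}" using mem[of i] mem[of j] by simp_all
    thus "symmetric_matrix (C j ** matrix_inv (C 1) ** C i)"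
      by (rule *(2))
  qed
next
  assume R: "?diag \<and> ?sym"
  have T: "transpose (matrix_inv (C 1)) = matrix_inv (C 1)"
    using symmetric_matrix_inv[OF assms(3)] assms(1,2) by (simp add: symmetric_matrix_def)
  have tr: "transpose (C j ** matrix_inv (C 1) ** C i) = C i ** matrix_inv (C 1) ** C j"
    if "i \<in> {2..m}" "j \<in> {2..m}" for i j
    using assms(2)[of i] assms(2)[of j] that T
    by (simp add: symmetric_matrix_def matrix_transpose_mul matrix_mul_assoc)
  have "symmetric_matrix (C j ** matrix_inv (C 1) ** C i)"
    if ij: "i \<in> {2..m}" "j \<in> {2..m}" for i j
  proof (cases i j rule: linorder_cases)
    case less
    thus ?thesis using R ij by simp
  next
    case equal
    thus ?thesis using tr[OF ij] by (simp add: symmetric_matrix_def)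
  next
    case greater
    hence "symmetric_matrix (C i ** matrix_inv (C 1) ** C j)" using R ij by simp
    thus ?thesis using tr ij by (metis symmetric_matrix_def)
  qed
  hence "SDC (insert (C 1) (C ` {2..m}))"
    using R assms(1,2,3) by (intro SDC_if_diagonalizable_commuting) auto
  moreover have "insert (C 1) (C ` {2..m}) = C ` {1..m}"
  proof -
    have "{1..m} = insert 1 {2..m}" using assms(1) by auto
    thus ?thesis by simp
  qed
  ultimately show ?sdc by simp
qed

end
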